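(* Assume Conditions 1, 2 and 3. Let $h_n^C:\Theta_n\to\mathbb{R}^p$ be the mapping $$h_n^C(\theta)=\tilde\theta+\gamma(n,l(\theta))(\theta-\tilde\theta),\qquad \theta\in\Theta_n,\qquad \gamma(n,l(\theta))=1+\frac{l(\theta)}{2n}.$$ Then: (i) $h_n^C$ has a unique fixed point, at $\tilde\theta$; (ii) $h_n^C$ is a similarity transformation for each individual contour $c(\tau)=\{\theta\in\Theta_n: l(\theta)=\tau\}$, $\tau\ge l(\tilde\theta)$, of $l$; (iii) $h_n^C$ is a surjection from $\Theta_n$ to $\mathbb{R}^p$.
   Context: Setting. $X\in\mathbb{R}^d$ is a random vector with a parameter $\theta_0\in\mathbb{R}^p$; $g(X,\theta)\in\mathbb{R}^q$ is an estimating function for $\theta_0$, with $E[g(X,\theta_0)]=0$; $X_1,\dots,X_n$ are independent copies of $X$, with $n>q$. The conditions are: Condition 1. $E[g(X,\theta_0)]=0$ and the variance matrix $V[g(X,\theta_0)]\in\mathbb{R}^{q\times q}$ is positive definite. Condition 2. $\partial g(X,\theta)/\partial\theta$ and $\partial^2 g(X,\theta)/\partial\theta\,\partial\theta^T$ are both continuous in $\theta$, and for $\theta$ in a neighbourhood of $\theta_0$ they are both bounded in norm by some integrable function of $X$. Condition 3. $\limsup_{\|t\|\to\infty}|E[\exp\{it^Tg(X,\theta_0)\}]|<1$ and $E\|g(X,\theta_0)\|^{15}<\infty$. Original empirical likelihood (OEL). For $\theta\in\mathbb{R}^p$, $$R(\theta)=\sup\Big\{\prod_{i=1}^n nw_i:\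 \sum_{i=1}^n w_ig(X_i,\theta)=0,\ w_i\ge 0,\ \sum_{i=1}^n w_i=1\Big\},\qquad l(\theta)=-2\log R(\theta).$$ The domain of $l$ is $$\Theta_n=\Big\{\theta\in\mathbb{R}^p:\ \text{there exist } w_1,\dots,w_n>0 \text{ with } \sum_{i=1}^n w_i=1 \text{ and } \sum_{i=1}^n w_ig(X_i,\theta)=0\Big\}.$$ For $\theta\in\Theta_n$, $l(\theta)=2\sum_{i=1}^n\log\{1+\lambda^Tg(X_i,\theta)\}$, where $\lambda=\lambda(\theta)\in\mathbb{R}^q$ satisfies $\sum_{i=1}^n g(X_i,\theta)/\{1+\lambda^Tg(X_i,\theta)\}=0$. Standing assumptions. $\Theta_n$ is a non-empty open subset of $\mathbb{R}^p$ containing $\theta_0$. $\tilde\theta\in\Theta_n$ denotes the $\sqrt n$-consistent maximum empirical likelihood estimator of $\theta_0$, i.e. the maximizer of $R$ (minimizer of $l$) over $\Theta_n$, with $\tilde\theta-\theta_0=O_p(n^{-1/2})$; in the just-determined case $p=q$ it is the solution of $\sum_{i=1}^n g(X_i,\theta)=0$, so that $l(\tilde\theta)=0$. A map is a similarity transformation for a contour $c(\tau)$ if on $c(\tau)$ it agrees with a similarity mapping of $\mathbb{R}^p$, i.e. a map that multiplies all Euclidean distances by one common positive constant (the constant may depend on $\tau$).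
   Formalization: Adds that for every θ in Θ_n the multiplier λ(θ), with all 1+λ^T g(X_i,θ)>0, is unique (the g(X_i,θ) span R^q); without this l can be discontinuous and surjectivity (iii) can fail. The standing assumptions are imposed sample by sample and the conclusion holds almost surely. *)

theory Defs
  imports "HOL-Probability.Probability"
begin

definition variance_matrix :: "'w measure \<Rightarrow> ('w \<Rightarrow> real ^ 'q) \<Rightarrow> real ^ 'q ^ 'q" where
  "variance_matrix M Y =
     (\<chi> i j. \<integral>\<omega>. (Y \<omega> $ i - (\<integral>\<omega>'. Y \<omega>' $ i \<partial>M)) * (Y \<omega> $ j - (\<integral>\<omega>'. Y \<omega>' $ j \<partial>M)) \<partial>M)"

definition positive_definite :: "real ^ 'q ^ 'q \<Rightarrow> bool" where
  "positive_definite A \<longleftrightarrow> transpose A = A \<and> (\<forall>v. v \<noteq> 0 \<longrightarrow> 0 < v \<bullet> (A *v v))"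

text \<open>Integrability is spelled out because the integral of a non-integrable function is \<open>0\<close>
  by convention.\<close>

definition condition1 ::
  "'w measure \<Rightarrow> ('w \<Rightarrow> real ^ 'd) \<Rightarrow> (real ^ 'd \<Rightarrow> real ^ 'p \<Rightarrow> real ^ 'q) \<Rightarrow> real ^ 'p \<Rightarrow> bool"
where
  "condition1 M X g \<theta>0 \<longleftrightarrow>
     integrable M (\<lambda>\<omega>. g (X \<omega>) \<theta>0) \<and> (\<integral>\<omega>. g (X \<omega>) \<theta>0 \<partial>M) = 0 \<and>
     integrable M (\<lambda>\<omega>. (norm (g (X \<omega>) \<theta>0))\<^sup>2) \<and>
     positive_definite (variance_matrix M (\<lambda>\<omega>. g (X \<omega>) \<theta>0))"

text \<open>\<open>D1 x \<theta>\<close> and \<open>D2 x \<theta>\<close> are the first and second Frechet derivatives of \<open>g x\<close> at \<open>\<theta>\<close>, i.e.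
  the arrays of first and second partial derivatives (given continuity, their existence in the
  two senses is equivalent). Their operator norms are equivalent to any other norm on these
  finite-dimensional spaces.\<close>

definition condition2 ::
  "'w measure \<Rightarrow> ('w \<Rightarrow> real ^ 'd) \<Rightarrow> (real ^ 'd \<Rightarrow> real ^ 'p \<Rightarrow> real ^ 'q) \<Rightarrow> real ^ 'p \<Rightarrow> bool"
where
  "condition2 M X g \<theta>0 \<longleftrightarrow>
     (\<exists>(D1 :: real ^ 'd \<Rightarrow> real ^ 'p \<Rightarrow> ((real ^ 'p) \<Rightarrow>\<^sub>L (real ^ 'q)))
       (D2 :: real ^ 'd \<Rightarrow> real ^ 'p \<Rightarrow> ((real ^ 'p) \<Rightarrow>\<^sub>L ((real ^ 'p) \<Rightarrow>\<^sub>L (real ^ 'q))))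
       (G :: real ^ 'd \<Rightarrow> real) N.
        open N \<and> \<theta>0 \<in> N \<and> integrable M (\<lambda>\<omega>. G (X \<omega>)) \<and>
        (AE x in distr M borel X.
           (\<forall>\<theta>. (g x has_derivative blinfun_apply (D1 x \<theta>)) (at \<theta>)) \<and>
           (\<forall>\<theta>. (D1 x has_derivative blinfun_apply (D2 x \<theta>)) (at \<theta>)) \<and>
           continuous_on UNIV (D1 x) \<and> continuous_on UNIV (D2 x) \<and>
           (\<forall>\<theta>\<in>N. norm (D1 x \<theta>) \<le> G x \<and> norm (D2 x \<theta>) \<le> G x)))"

definition condition3 ::
  "'w measure \<Rightarrow> ('w \<Rightarrow> real ^ 'd) \<Rightarrow> (real ^ 'd \<Rightarrow> real ^ 'p \<Rightarrow> real ^ 'q) \<Rightarrow> real ^ 'p \<Rightarrow> bool"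
where
  "condition3 M X g \<theta>0 \<longleftrightarrow>
     Limsup at_infinity
       (\<lambda>t. ereal (cmod (\<integral>\<omega>. exp (\<i> * complex_of_real (t \<bullet> g (X \<omega>) \<theta>0)) \<partial>M))) < 1 \<and>
     integrable M (\<lambda>\<omega>. norm (g (X \<omega>) \<theta>0) ^ 15)"

definition bigo_in_probability ::
  "'w measure \<Rightarrow> (nat \<Rightarrow> 'w \<Rightarrow> 'b::real_normed_vector) \<Rightarrow> (nat \<Rightarrow> real) \<Rightarrow> bool" where
  "bigo_in_probability M Y a \<longleftrightarrow>
     (\<forall>\<epsilon>>0. \<exists>K. \<forall>\<^sub>F n in sequentially.
        measure M {\<omega> \<in> space M. norm (Y n \<omega>) > K * a n} < \<epsilon>)"

text \<open>A sample of size \<open>n\<close> is \<open>x 0, \<dots>, x (n - 1)\<close>; later values of \<open>x\<close> are ignored.\<close>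

text \<open>\<open>el_ratio\<close> is only meaningful where \<open>0\<close> lies in the convex hull of the \<open>g (x i) \<theta>\<close>
  (otherwise it is the unspecified supremum of the empty set); it is used below only on
  \<open>el_domain\<close>, where moreover it is positive.\<close>

definition el_ratio ::
  "('a \<Rightarrow> 'b \<Rightarrow> 'c::real_vector) \<Rightarrow> nat \<Rightarrow> (nat \<Rightarrow> 'a) \<Rightarrow> 'b \<Rightarrow> real" where
  "el_ratio g n x \<theta> =
     Sup {\<Prod>i<n. real n * w i | w.
            (\<Sum>i<n. w i *\<^sub>R g (x i) \<theta>) = 0 \<and> (\<forall>i<n. 0 \<le> w i) \<and> (\<Sum>i<n. w i) = 1}"

definition el_loglik ::
  "('a \<Rightarrow> 'b \<Rightarrow> 'c::real_vector) \<Rightarrow> nat \<Rightarrow> (nat \<Rightarrow> 'a) \<Rightarrow> 'b \<Rightarrow> real" where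
  "el_loglik g n x \<theta> = - 2 * ln (el_ratio g n x \<theta>)"

definition el_domain ::
  "('a \<Rightarrow> 'b \<Rightarrow> 'c::real_vector) \<Rightarrow> nat \<Rightarrow> (nat \<Rightarrow> 'a) \<Rightarrow> 'b set" where
  "el_domain g n x =
     {\<theta>. \<exists>w. (\<forall>i<n. 0 < w i) \<and> (\<Sum>i<n. w i) = 1 \<and> (\<Sum>i<n. w i *\<^sub>R g (x i) \<theta>) = 0}"

definition el_contour ::
  "('a \<Rightarrow> 'b \<Rightarrow> 'c::real_vector) \<Rightarrow> nat \<Rightarrow> (nat \<Rightarrow> 'a) \<Rightarrow> real \<Rightarrow> 'b set" where
  "el_contour g n x \<tau> = {\<theta> \<in> el_domain g n x. el_loglik g n x \<theta> = \<tau>}"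

text \<open>\<open>\<lambda>\<close> solves the multiplier equation at \<open>\<theta>\<close>; positivity of the denominators makes
  \<open>ln (1 + \<lambda> \<bullet> g (x i) \<theta>)\<close> in the dual form of the log-likelihood meaningful.\<close>

definition el_multiplier ::
  "('a \<Rightarrow> 'b \<Rightarrow> 'c::real_inner) \<Rightarrow> nat \<Rightarrow> (nat \<Rightarrow> 'a) \<Rightarrow> 'b \<Rightarrow> 'c \<Rightarrow> bool" where
  "el_multiplier g n x \<theta> lam \<longleftrightarrow>
     (\<forall>i<n. 0 < 1 + lam \<bullet> g (x i) \<theta>) \<and>
     (\<Sum>i<n. (1 / (1 + lam \<bullet> g (x i) \<theta>)) *\<^sub>R g (x i) \<theta>) = 0"

text \<open>The regularity required of a single sample, with \<open>t\<close> the maximum empirical likelihood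
  estimate. That the multiplier is a well-defined function \<open>\<lambda>(\<theta>)\<close> on the domain amounts to the
  \<open>g (x i) \<theta>\<close> spanning the whole space; otherwise \<open>0\<close> is only a relative interior point of
  their convex hull and the log-likelihood need not be continuous.\<close>

definition regular_sample ::
  "('a \<Rightarrow> real ^ 'p \<Rightarrow> real ^ 'q) \<Rightarrow> nat \<Rightarrow> (nat \<Rightarrow> 'a) \<Rightarrow> real ^ 'p \<Rightarrow> real ^ 'p \<Rightarrow> bool" where
  "regular_sample g n x \<theta>0 t \<longleftrightarrow>
     open (el_domain g n x) \<and> \<theta>0 \<in> el_domain g n x \<and>
     (\<forall>\<theta>\<in>el_domain g n x. \<exists>!lam. el_multiplier g n x \<theta> lam) \<and>
     (\<forall>\<theta>. is_arg_max (el_ratio g n x) (\<lambda>\<theta>. \<theta> \<in> el_domain g n x) \<theta> \<longleftrightarrow> \<theta> = t) \<and>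
     (CARD('p) = CARD('q) \<longrightarrow> (\<forall>\<theta>. (\<Sum>i<n. g (x i) \<theta>) = 0 \<longleftrightarrow> \<theta> = t))"

definition expansion_factor :: "nat \<Rightarrow> real \<Rightarrow> real" where
  "expansion_factor n l = 1 + l / (2 * real n)"

definition el_extension ::
  "('a \<Rightarrow> 'b::real_vector \<Rightarrow> 'c::real_vector) \<Rightarrow> nat \<Rightarrow> (nat \<Rightarrow> 'a) \<Rightarrow> 'b \<Rightarrow> 'b \<Rightarrow> 'b" where
  "el_extension g n x t \<theta> = t + expansion_factor n (el_loglik g n x \<theta>) *\<^sub>R (\<theta> - t)"

definition similarity_mapping :: "('b::metric_space \<Rightarrow> 'b) \<Rightarrow> bool" where
  "similarity_mapping S \<longleftrightarrow> (\<exists>c>0. \<forall>u v. dist (S u) (S v) = c * dist u v)"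

definition similarity_on :: "('b::metric_space \<Rightarrow> 'b) \<Rightarrow> 'b set \<Rightarrow> bool" where
  "similarity_on h C \<longleftrightarrow> (\<exists>S. similarity_mapping S \<and> (\<forall>\<theta>\<in>C. h \<theta> = S \<theta>))"

end

theory Submission
  imports Defs
begin

text \<open>
  Everything is a deterministic statement about one sample, once each \<open>g (x i)\<close> is known to be
  continuous in the parameter. Condition 2 gives this almost surely for an observation distributed
  as \<open>X\<close>, hence almost surely for all observations at once (\<open>AE_sample_continuous\<close>).

  The log-likelihood \<open>l\<close> is handled through its dual form \<open>l = 2 * (\<Sum>i. ln (1 + \<lambda> \<bullet> g (x i) \<theta>))\<close>
  (\<open>el_loglik_multiplier\<close>), which is the inequality of the arithmetic and geometric means together
  with its case of equality. The same inequality gives \<open>R \<le> 1\<close>, so \<open>l \<ge> 0\<close> and the expansion factor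
  \<open>1 + l / (2 * n)\<close> is at least \<open>1\<close>. Two of the three claims follow at once: on a contour the factor is
  a positive constant, so the map is a homothety with centre \<open>t\<close>; and a fixed point other than \<open>t\<close>
  would need \<open>l = 0\<close>, that is \<open>R = 1\<close>, the largest possible value, although \<open>t\<close> is the only
  maximizer of \<open>R\<close>.

  Surjectivity rests on two analytic facts. First, \<open>l\<close> is continuous on its domain
  (\<open>continuous_on_el_loglik\<close>): multipliers cannot escape to infinity near a point \<open>\<theta>\<close> of
  the domain, because a limiting direction would put all \<open>g (x i) \<theta>\<close> into a closed half space;
  as a positive combination of them vanishes, they would lie in its boundary hyperplane, and then
  the multiplier at \<open>\<theta>\<close> would not be unique. Second, \<open>l\<close> tends to infinity at the boundary of the
  domain (\<open>el_domain_limit_of_bounded_loglik\<close>): if \<open>l\<close> stays bounded, the optimal weights stay away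
  from \<open>0\<close>, and their limits are positive weights for the limit parameter. The map sends the ray
  from \<open>t\<close> through \<open>z\<close> to itself, moving the point at position \<open>s\<close> to position
  \<open>f s = s * (1 + l / (2 * n)) \<ge> s\<close>, with \<open>z\<close> at position \<open>1\<close>. As \<open>s\<close> grows from \<open>0\<close>, either the ray
  stays in the domain up to \<open>s = 1\<close>, where \<open>f 1 \<ge> 1\<close>, or it leaves the domain earlier and \<open>f\<close> tends
  to infinity there. Either way \<open>f\<close> takes the value \<open>1\<close>, so \<open>z\<close> is in the image
  (\<open>el_extension_surj\<close>).
\<close>

section \<open>Duality for the empirical likelihood\<close>

text \<open>The inequality of the arithmetic and geometric means in the normalization met here, obtained
  by multiplying the tangent-line bounds \<open>y i \<le> exp (y i - 1)\<close>.\<close>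
lemma prod_le_one_of_sum_eq_card:
  fixes y :: "nat \<Rightarrow> real"
  assumes "\<And>i. i < n \<Longrightarrow> 0 \<le> y i" and "(\<Sum>i<n. y i) = real n"
  shows "(\<Prod>i<n. y i) \<le> 1"
proof -
  have "(\<Prod>i<n. y i) \<le> (\<Prod>i<n. exp (y i - 1))"
    using assms(1) exp_ge_add_one_self[of "y _ - 1"] by (intro prod_mono) auto
  also have "\<dots> = exp (\<Sum>i<n. y i - 1)"
    by (simp add: exp_sum)
  also have "\<dots> = 1"
    using assms(2) by (simp add: sum_subtractf)
  finally show ?thesis .
qed

text \<open>Pairing the multiplier equation with \<open>\<lambda>\<close> shows that the weights \<open>1 / (n * (1 + \<lambda> \<bullet> g (x i) \<theta>))\<close>
  sum to \<open>1\<close>; the multiplier equation itself says that they satisfy the estimating equation.\<close>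
lemma el_multiplier_sum_inverse:
  assumes "el_multiplier g n x \<theta> lam"
  shows "(\<Sum>i<n. 1 / (1 + lam \<bullet> g (x i) \<theta>)) = real n"
proof -
  let ?d = "\<lambda>i. 1 + lam \<bullet> g (x i) \<theta>"
  have pos: "\<And>i. i < n \<Longrightarrow> 0 < ?d i"
    and eq: "(\<Sum>i<n. (1 / ?d i) *\<^sub>R g (x i) \<theta>) = 0"
    using assms by (auto simp: el_multiplier_def)
  have "0 = lam \<bullet> (\<Sum>i<n. (1 / ?d i) *\<^sub>R g (x i) \<theta>)"
    using eq by simp
  also have "\<dots> = (\<Sum>i<n. 1 - 1 / ?d i)"
    unfolding inner_sum_right
  proof (rule sum.cong[OF refl])
    fix i assume "i \<in> {..<n}"
    then have "?d i \<noteq> 0" using pos[of i] by auto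
    then show "lam \<bullet> ((1 / ?d i) *\<^sub>R g (x i) \<theta>) = 1 - 1 / ?d i"
      by (simp add: field_simps)
  qed
  also have "\<dots> = real n - (\<Sum>i<n. 1 / ?d i)"
    by (simp add: sum_subtractf)
  finally show ?thesis by simp
qed

text \<open>No weight exceeds the total \<open>1\<close>. This uniform bound keeps the denominators away from \<open>0\<close> in
  limits of multipliers.\<close>
lemma el_multiplier_denominator_ge:
  assumes "el_multiplier g n x \<theta> lam" and "i < n"
  shows "1 / real n \<le> 1 + lam \<bullet> g (x i) \<theta>"
proof -
  let ?d = "\<lambda>i. 1 + lam \<bullet> g (x i) \<theta>"
  have pos: "\<And>i. i < n \<Longrightarrow> 0 < ?d i"
    using assms by (auto simp: el_multiplier_def)
  have "1 / ?d i \<le> (\<Sum>i<n. 1 / ?d i)"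
    using assms(2) pos by (intro member_le_sum) (auto simp: less_imp_le)
  also have "\<dots> = real n"
    using el_multiplier_sum_inverse[OF assms(1)] .
  finally show ?thesis
    using pos[OF assms(2)] assms(2) by (simp add: field_simps)
qed

text \<open>For weights \<open>w\<close> admitted in the supremum, the numbers \<open>n * w i * (1 + \<lambda> \<bullet> g (x i) \<theta>)\<close> have sum \<open>n\<close>,
  because the estimating equation removes \<open>\<lambda>\<close>. Their product is therefore at most \<open>1\<close>, with
  equality for the weights given by the multiplier.\<close>
lemma el_ratio_multiplier:
  assumes "el_multiplier g n x \<theta> lam" and "0 < n"
  shows "el_ratio g n x \<theta> = (\<Prod>i<n. 1 / (1 + lam \<bullet> g (x i) \<theta>))"
proof -
  let ?d = "\<lambda>i. 1 + lam \<bullet> g (x i) \<theta>"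
  let ?W = "\<lambda>w. (\<Sum>i<n. w i *\<^sub>R g (x i) \<theta>) = 0 \<and> (\<forall>i<n. 0 \<le> w i) \<and> (\<Sum>i<n. w i) = (1::real)"
  have pos: "\<And>i. i < n \<Longrightarrow> 0 < ?d i"
    and eq: "(\<Sum>i<n. (1 / ?d i) *\<^sub>R g (x i) \<theta>) = 0"
    using assms by (auto simp: el_multiplier_def)
  define w0 where "w0 i = 1 / (real n * ?d i)" for i
  have "(\<Sum>i<n. w0 i *\<^sub>R g (x i) \<theta>) = (1 / real n) *\<^sub>R (\<Sum>i<n. (1 / ?d i) *\<^sub>R g (x i) \<theta>)"
    by (simp add: w0_def scaleR_sum_right)
  moreover have "(\<Sum>i<n. w0 i) = (1 / real n) * (\<Sum>i<n. 1 / ?d i)"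
    by (simp add: w0_def sum_distrib_left)
  ultimately have W0: "?W w0"
    using eq el_multiplier_sum_inverse[OF assms(1)] assms(2) pos
    by (auto simp: w0_def less_imp_le)
  have prod0: "(\<Prod>i<n. real n * w0 i) = (\<Prod>i<n. 1 / ?d i)"
    using assms(2) by (simp add: w0_def)
  have upper: "(\<Prod>i<n. real n * w i) \<le> (\<Prod>i<n. 1 / ?d i)" if W: "?W w" for w
  proof -
    have "(\<Sum>i<n. real n * w i * ?d i)
        = real n * ((\<Sum>i<n. w i) + lam \<bullet> (\<Sum>i<n. w i *\<^sub>R g (x i) \<theta>))"
      by (simp add: inner_sum_right sum_distrib_left sum.distrib algebra_simps)
    also have "\<dots> = real n" using W by simp
    finally have "(\<Prod>i<n. real n * w i * ?d i) \<le> 1"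
      using W pos by (intro prod_le_one_of_sum_eq_card) (auto simp: less_imp_le)
    moreover have "0 < (\<Prod>i<n. ?d i)" using pos by (auto intro: prod_pos)
    ultimately have "(\<Prod>i<n. real n * w i) \<le> 1 / (\<Prod>i<n. ?d i)"
      unfolding prod.distrib[of _ ?d] by (simp only: pos_le_divide_eq)
    then show ?thesis by (simp add: prod_dividef)
  qed
  show ?thesis
    unfolding el_ratio_def
    by (rule cSup_eq_maximum) (use W0 prod0 upper in force)+
qed

lemma el_loglik_multiplier:
  assumes "el_multiplier g n x \<theta> lam" and "0 < n"
  shows "el_loglik g n x \<theta> = 2 * (\<Sum>i<n. ln (1 + lam \<bullet> g (x i) \<theta>))"
proof -
  have pos: "\<And>i. i < n \<Longrightarrow> 0 < 1 + lam \<bullet> g (x i) \<theta>"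
    using assms by (auto simp: el_multiplier_def)
  have "ln (\<Prod>i<n. 1 / (1 + lam \<bullet> g (x i) \<theta>)) = (\<Sum>i<n. ln (1 / (1 + lam \<bullet> g (x i) \<theta>)))"
  proof (rule ln_prod)
    fix i assume "i \<in> {..<n}"
    then show "1 / (1 + lam \<bullet> g (x i) \<theta>) \<noteq> 0" using pos[of i] by auto
  qed simp
  also have "\<dots> = (\<Sum>i<n. - ln (1 + lam \<bullet> g (x i) \<theta>))"
    using pos by (intro sum.cong) (auto simp: ln_div)
  finally show ?thesis
    unfolding el_loglik_def el_ratio_multiplier[OF assms] by (simp add: sum_negf)
qed

lemma el_ratio_pos_le_one:
  assumes "el_multiplier g n x \<theta> lam" and "0 < n"
  shows "0 < el_ratio g n x \<theta>" and "el_ratio g n x \<theta> \<le> 1"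
proof -
  have pos: "\<And>i. i < n \<Longrightarrow> 0 < 1 + lam \<bullet> g (x i) \<theta>"
    using assms by (auto simp: el_multiplier_def)
  show "0 < el_ratio g n x \<theta>"
    unfolding el_ratio_multiplier[OF assms] using pos by (auto intro!: prod_pos)
  show "el_ratio g n x \<theta> \<le> 1"
    unfolding el_ratio_multiplier[OF assms]
    using pos el_multiplier_sum_inverse[OF assms(1)]
    by (intro prod_le_one_of_sum_eq_card) (auto simp: less_imp_le)
qed

lemma el_loglik_nonneg:
  assumes "el_multiplier g n x \<theta> lam" and "0 < n"
  shows "0 \<le> el_loglik g n x \<theta>"
  using el_ratio_pos_le_one[OF assms] by (simp add: el_loglik_def)

section \<open>Blow-up of the log-likelihood at the boundary of the domain\<close>

text \<open>Sequential compactness of a cube whose dimension \<open>n\<close> is a number rather than a type.\<close>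
lemma convergent_subsequence_components:
  fixes w :: "nat \<Rightarrow> nat \<Rightarrow> real"
  assumes "\<And>k i. i < n \<Longrightarrow> w k i \<in> {a..b}"
  shows "\<exists>r v. strict_mono r \<and> (\<forall>i<n. v i \<in> {a..b} \<and> (\<lambda>k. w (r k) i) \<longlonglongrightarrow> v i)"
  using assms
proof (induction n)
  case 0
  show ?case by (rule exI[of _ id]) (simp add: strict_mono_def)
next
  case (Suc n)
  then obtain r v where r: "strict_mono r"
    and v: "\<forall>i<n. v i \<in> {a..b} \<and> (\<lambda>k. w (r k) i) \<longlonglongrightarrow> v i"
    by (metis less_Suc_eq)
  obtain s c where c: "c \<in> {a..b}" and s: "strict_mono s" and lim: "((\<lambda>k. w (r k) n) \<circ> s) \<longlonglongrightarrow> c"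
    using Suc.prems[of n] compact_Icc[of a b] unfolding compact_def by (metis lessI)
  have "(v(n := c)) i \<in> {a..b} \<and> (\<lambda>k. w ((r \<circ> s) k) i) \<longlonglongrightarrow> (v(n := c)) i" if "i < Suc n" for i
  proof (cases "i = n")
    case True
    then show ?thesis using c lim by (simp add: o_def)
  next
    case False
    then have "v i \<in> {a..b}" and "(\<lambda>k. w (r k) i) \<longlonglongrightarrow> v i" using v that by auto
    then show ?thesis using False LIMSEQ_subseq_LIMSEQ[OF _ s, of "\<lambda>k. w (r k) i"]
      by (simp add: o_def)
  qed
  then show ?case using strict_mono_o[OF r s] by blast
qed

text \<open>The multipliers of the \<open>u k\<close> may be unbounded, so the limit is taken in the optimal weights
  instead. A bound on the product of the denominators, none of which is below \<open>1 / n\<close>, bounds each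
  of them from above, and so each weight from below by a positive constant. Limits of the weights are
  then positive and solve the estimating equation at \<open>\<theta>\<close>.\<close>
lemma el_domain_limit_of_bounded_loglik:
  fixes g :: "'a \<Rightarrow> 'b::t2_space \<Rightarrow> 'c::real_inner"
  assumes cont: "\<And>i. i < n \<Longrightarrow> isCont (g (x i)) \<theta>"
    and lim: "u \<longlonglongrightarrow> \<theta>"
    and mult: "\<And>k. \<exists>lam. el_multiplier g n x (u k) lam"
    and bound: "\<And>k. el_loglik g n x (u k) \<le> B"
    and "0 < n"
  shows "\<theta> \<in> el_domain g n x"
proof -
  obtain L where L: "\<And>k. el_multiplier g n x (u k) (L k)"
    using mult by metis
  define d where "d k i = 1 + L k \<bullet> g (x i) (u k)" for k i
  have pos: "0 < d k i" if "i < n" for k i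
    using L that by (auto simp: el_multiplier_def d_def)
  define w where "w k i = 1 / (real n * d k i)" for k i
  define c where "c = exp (- (B / 2 + real n * ln n)) / real n"
  have "0 < c" using \<open>0 < n\<close> by (simp add: c_def)
  have w: "w k i \<in> {c..1}" if "i < n" for k i
  proof -
    have dge: "1 / real n \<le> d k j" if "j < n" for j
      using el_multiplier_denominator_ge[OF L that] by (simp add: d_def)
    have nn: "0 \<le> ln (d k j) + ln n" if "j < n" for j
    proof -
      have "1 \<le> d k j * real n" using dge[OF that] \<open>0 < n\<close> by (simp add: field_simps)
      then have "0 \<le> ln (d k j * real n)" by simp
      also have "\<dots> = ln (d k j) + ln n"
        using pos[OF that, of k] \<open>0 < n\<close> by (intro ln_mult_pos) auto
      finally show ?thesis .
    qed
    \<comment> \<open>Adding \<open>ln n\<close> makes every summand nonnegative, so that one of them is at most the sum.\<close>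
    have "ln (d k i) + ln n \<le> (\<Sum>j<n. ln (d k j) + ln n)"
      using nn that by (intro member_le_sum) auto
    also have "\<dots> = el_loglik g n x (u k) / 2 + real n * ln n"
      unfolding el_loglik_multiplier[OF L \<open>0 < n\<close>] by (simp add: d_def sum.distrib)
    also have "\<dots> \<le> B / 2 + real n * ln n" using bound[of k] by simp
    finally have "ln (d k i) \<le> B / 2 + real n * ln n"
      using \<open>0 < n\<close> by (smt (verit) ln_ge_zero of_nat_1 of_nat_mono Suc_leI One_nat_def)
    then have "d k i \<le> exp (B / 2 + real n * ln n)"
      using pos[OF that] by (metis exp_le_cancel_iff exp_ln)
    then have "c \<le> w k i"
      using pos[OF that, of k] \<open>0 < n\<close> by (simp add: c_def w_def exp_minus field_simps)
    moreover have "w k i \<le> 1"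
      using dge[OF that] pos[OF that, of k] \<open>0 < n\<close> by (simp add: w_def field_simps)
    ultimately show ?thesis by simp
  qed
  obtain r v where r: "strict_mono r"
    and v: "\<And>i. i < n \<Longrightarrow> v i \<in> {c..1}" "\<And>i. i < n \<Longrightarrow> (\<lambda>k. w (r k) i) \<longlonglongrightarrow> v i"
    using convergent_subsequence_components[of n w c 1] w by blast
  have ur: "(\<lambda>k. u (r k)) \<longlonglongrightarrow> \<theta>"
    using LIMSEQ_subseq_LIMSEQ[OF lim r] by (simp add: o_def)
  have gr: "(\<lambda>k. g (x i) (u (r k))) \<longlonglongrightarrow> g (x i) \<theta>" if "i < n" for i
    using isCont_tendsto_compose[OF cont[OF that] ur] .
  have "(\<lambda>k. \<Sum>i<n. w (r k) i) \<longlonglongrightarrow> (\<Sum>i<n. v i)"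
    using v by (intro tendsto_sum) auto
  moreover have "(\<Sum>i<n. w k i) = 1" for k
  proof -
    have "(\<Sum>i<n. w k i) = (1 / real n) * (\<Sum>i<n. 1 / d k i)"
      by (simp add: w_def sum_distrib_left)
    then show ?thesis
      using el_multiplier_sum_inverse[OF L[of k]] \<open>0 < n\<close> by (simp add: d_def)
  qed
  ultimately have sum1: "(\<Sum>i<n. v i) = 1"
    by (simp add: LIMSEQ_const_iff)
  have "(\<lambda>k. \<Sum>i<n. w (r k) i *\<^sub>R g (x i) (u (r k))) \<longlonglongrightarrow> (\<Sum>i<n. v i *\<^sub>R g (x i) \<theta>)"
    using v gr by (intro tendsto_sum tendsto_scaleR) auto
  moreover have "(\<Sum>i<n. w k i *\<^sub>R g (x i) (u k)) = 0" for k
  proof -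
    have "(\<Sum>i<n. w k i *\<^sub>R g (x i) (u k))
        = (1 / real n) *\<^sub>R (\<Sum>i<n. (1 / d k i) *\<^sub>R g (x i) (u k))"
      by (simp add: w_def scaleR_sum_right)
    then show ?thesis
      using L[of k] by (simp add: d_def el_multiplier_def)
  qed
  ultimately have sum0: "(\<Sum>i<n. v i *\<^sub>R g (x i) \<theta>) = 0"
    by (simp add: LIMSEQ_const_iff)
  show ?thesis
    unfolding el_domain_def using sum0 sum1 v(1) \<open>0 < c\<close>
    by (auto intro!: exI[of _ v] intro: less_le_trans)
qed

section \<open>Continuity of the log-likelihood\<close>

text \<open>Adding to a multiplier a vector orthogonal to all \<open>g (x i) \<theta>\<close> gives another multiplier.\<close>
lemma el_multiplier_unique_imp_spanning:
  assumes "\<exists>!lam. el_multiplier g n x \<theta> lam" and "\<And>i. i < n \<Longrightarrow> v \<bullet> g (x i) \<theta> = 0"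
  shows "v = 0"
proof -
  obtain lam where lam: "el_multiplier g n x \<theta> lam" using assms(1) by blast
  have "el_multiplier g n x \<theta> (lam + v)"
    using lam assms(2) by (simp add: el_multiplier_def inner_add_left)
  then have "lam + v = lam" using assms(1) lam by blast
  then show ?thesis by simp
qed

text \<open>The pair \<open>(1, \<lambda>)\<close> is scaled to \<open>(a, a *\<^sub>R \<lambda>)\<close> with \<open>a + norm (a *\<^sub>R \<lambda>) = 1\<close>, which brings bounded and
  unbounded sequences of multipliers into one compact set. A limit \<open>(0, v)\<close> would be a
  multiplier at infinity: then \<open>v \<bullet> g (x i) \<theta> \<ge> 0\<close> for all \<open>i\<close> with a vanishing positive combination,
  so \<open>v\<close> is orthogonal to all \<open>g (x i) \<theta>\<close> and \<open>v = 0\<close>, against \<open>norm v = 1\<close>. Hence the limit \<open>(\<alpha>, v)\<close>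
  has \<open>\<alpha> > 0\<close>, the subsequence converges to \<open>v / \<alpha>\<close>, and this is a multiplier at \<open>\<theta>\<close>, so it is
  the given one.\<close>
lemma el_multiplier_limit_point:
  fixes g :: "'a \<Rightarrow> 'b::t2_space \<Rightarrow> 'c::euclidean_space"
  assumes cont: "\<And>i. i < n \<Longrightarrow> isCont (g (x i)) \<theta>"
    and lim: "u \<longlonglongrightarrow> \<theta>"
    and L: "\<And>k. el_multiplier g n x (u k) (L k)"
    and dom: "\<theta> \<in> el_domain g n x"
    and uniq: "\<exists>!lam. el_multiplier g n x \<theta> lam"
    and lam: "el_multiplier g n x \<theta> lam"
    and "0 < n"
  shows "\<exists>r. strict_mono r \<and> (\<lambda>k. L (r k)) \<longlonglongrightarrow> lam"
proof -
  define a where "a k = 1 / (1 + norm (L k))" for k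
  have apos: "0 < a k" for k by (simp add: a_def add_pos_nonneg)
  have anorm: "a k + norm (a k *\<^sub>R L k) = 1" for k
    using apos[of k] by (simp add: a_def field_simps add_nonneg_eq_0_iff)
  have "(a k, a k *\<^sub>R L k) \<in> {0..1} \<times> cball 0 1" for k
    using apos[of k] anorm[of k] norm_ge_zero[of "a k *\<^sub>R L k"]
    unfolding mem_Times_iff fst_conv snd_conv atLeastAtMost_iff mem_cball_0 by linarith
  moreover have "compact ({0..1::real} \<times> cball (0::'c) 1)"
    by (intro compact_Times) auto
  ultimately obtain p r where r: "strict_mono r" and p: "((\<lambda>k. (a k, a k *\<^sub>R L k)) \<circ> r) \<longlonglongrightarrow> p"
    unfolding compact_def by (metis (no_types, lifting))
  define \<alpha> v where "\<alpha> = fst p" and "v = snd p"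
  have al: "(\<lambda>k. a (r k)) \<longlonglongrightarrow> \<alpha>" and vl: "(\<lambda>k. a (r k) *\<^sub>R L (r k)) \<longlonglongrightarrow> v"
    using tendsto_fst[OF p] tendsto_snd[OF p] by (simp_all add: o_def \<alpha>_def v_def)
  have gr: "(\<lambda>k. g (x i) (u (r k))) \<longlonglongrightarrow> g (x i) \<theta>" if "i < n" for i
    using isCont_tendsto_compose[OF cont[OF that]] LIMSEQ_subseq_LIMSEQ[OF lim r]
    by (simp add: o_def)
  have "(\<lambda>k. a (r k) + norm (a (r k) *\<^sub>R L (r k))) \<longlonglongrightarrow> \<alpha> + norm v"
    by (intro tendsto_add tendsto_norm al vl)
  then have one: "\<alpha> + norm v = 1"
    unfolding anorm using LIMSEQ_unique[OF tendsto_const] by metis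
  have ge: "\<alpha> / real n \<le> \<alpha> + v \<bullet> g (x i) \<theta>" if "i < n" for i
  proof (rule LIMSEQ_le)
    show "(\<lambda>k. a (r k) / real n) \<longlonglongrightarrow> \<alpha> / real n"
      using \<open>0 < n\<close> by (intro tendsto_divide al tendsto_const) auto
    show "(\<lambda>k. a (r k) + (a (r k) *\<^sub>R L (r k)) \<bullet> g (x i) (u (r k))) \<longlonglongrightarrow> \<alpha> + v \<bullet> g (x i) \<theta>"
      by (intro tendsto_add tendsto_inner al vl gr that)
    have "a (r k) / real n \<le> a (r k) + (a (r k) *\<^sub>R L (r k)) \<bullet> g (x i) (u (r k))" for k
      using mult_left_mono[OF el_multiplier_denominator_ge[OF L[of "r k"] that] less_imp_le[OF apos[of "r k"]]]
      by (simp add: algebra_simps)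
    then show "\<exists>N. \<forall>k\<ge>N. a (r k) / real n \<le> a (r k) + (a (r k) *\<^sub>R L (r k)) \<bullet> g (x i) (u (r k))"
      by blast
  qed
  have "0 \<le> \<alpha>"
    using al apos by (meson LIMSEQ_le_const less_imp_le)
  have "\<alpha> \<noteq> 0"
  proof
    assume "\<alpha> = 0"
    obtain w where w: "\<And>i. i < n \<Longrightarrow> 0 < w i" "(\<Sum>i<n. w i *\<^sub>R g (x i) \<theta>) = 0"
      using dom by (auto simp: el_domain_def)
    have nn: "0 \<le> w i * (v \<bullet> g (x i) \<theta>)" if "i < n" for i
      using ge[OF that] w(1)[OF that] \<open>\<alpha> = 0\<close> by simp
    have "(\<Sum>i<n. w i * (v \<bullet> g (x i) \<theta>)) = v \<bullet> (\<Sum>i<n. w i *\<^sub>R g (x i) \<theta>)"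
      by (simp add: inner_sum_right)
    then have "\<forall>i\<in>{..<n}. w i * (v \<bullet> g (x i) \<theta>) = 0"
      using nn w(2) sum_nonneg_eq_0_iff[of "{..<n}" "\<lambda>i. w i * (v \<bullet> g (x i) \<theta>)"] by auto
    then have "v = 0"
      using w(1) by (intro el_multiplier_unique_imp_spanning[OF uniq]) force
    then show False using one \<open>\<alpha> = 0\<close> by simp
  qed
  with \<open>0 \<le> \<alpha>\<close> have "0 < \<alpha>" by simp
  have "(\<lambda>k. (1 / a (r k)) *\<^sub>R (a (r k) *\<^sub>R L (r k))) \<longlonglongrightarrow> (1 / \<alpha>) *\<^sub>R v"
    using \<open>0 < \<alpha>\<close> by (intro tendsto_scaleR tendsto_divide al vl tendsto_const) auto
  then have Llim: "(\<lambda>k. L (r k)) \<longlonglongrightarrow> (1 / \<alpha>) *\<^sub>R v" (is "_ \<longlonglongrightarrow> ?m")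
    using apos by (simp add: less_imp_neq[THEN not_sym])
  have den: "(\<lambda>k. 1 + L (r k) \<bullet> g (x i) (u (r k))) \<longlonglongrightarrow> 1 + ?m \<bullet> g (x i) \<theta>" if "i < n" for i
    by (intro tendsto_add tendsto_inner Llim gr that tendsto_const)
  have pos: "0 < 1 + ?m \<bullet> g (x i) \<theta>" if "i < n" for i
  proof -
    have "1 / real n \<le> 1 + ?m \<bullet> g (x i) \<theta>"
      using den[OF that] el_multiplier_denominator_ge[OF L that] by (meson LIMSEQ_le_const)
    then show ?thesis using \<open>0 < n\<close> by (smt (verit) divide_pos_pos of_nat_0_less_iff)
  qed
  have "(\<lambda>k. \<Sum>i<n. (1 / (1 + L (r k) \<bullet> g (x i) (u (r k)))) *\<^sub>R g (x i) (u (r k)))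
      \<longlonglongrightarrow> (\<Sum>i<n. (1 / (1 + ?m \<bullet> g (x i) \<theta>)) *\<^sub>R g (x i) \<theta>)"
    using pos by (intro tendsto_sum tendsto_scaleR tendsto_divide den gr tendsto_const) force+
  moreover have "(\<Sum>i<n. (1 / (1 + L (r k) \<bullet> g (x i) (u (r k)))) *\<^sub>R g (x i) (u (r k))) = 0" for k
    using L[of "r k"] by (simp add: el_multiplier_def)
  ultimately have "(\<Sum>i<n. (1 / (1 + ?m \<bullet> g (x i) \<theta>)) *\<^sub>R g (x i) \<theta>) = 0"
    by (simp only: LIMSEQ_const_iff)
  then have "el_multiplier g n x \<theta> ?m"
    using pos unfolding el_multiplier_def by blast
  then have "?m = lam" using uniq lam by blast
  then show ?thesis using r Llim by blast
qed

lemma continuous_on_el_multiplier: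
  fixes g :: "'a \<Rightarrow> 'b::metric_space \<Rightarrow> 'c::euclidean_space"
  assumes cont: "\<And>i \<theta>. i < n \<Longrightarrow> \<theta> \<in> el_domain g n x \<Longrightarrow> isCont (g (x i)) \<theta>"
    and uniq: "\<And>\<theta>. \<theta> \<in> el_domain g n x \<Longrightarrow> \<exists>!lam. el_multiplier g n x \<theta> lam"
    and L: "\<And>\<theta>. \<theta> \<in> el_domain g n x \<Longrightarrow> el_multiplier g n x \<theta> (L \<theta>)"
    and "0 < n"
  shows "continuous_on (el_domain g n x) L"
proof (rule ccontr)
  assume "\<not> continuous_on (el_domain g n x) L"
  then obtain \<theta> e where th: "\<theta> \<in> el_domain g n x" and "e > 0"
    and far: "\<And>d. d > 0 \<Longrightarrow> \<exists>\<theta>'\<in>el_domain g n x. dist \<theta>' \<theta> < d \<and> e \<le> dist (L \<theta>') (L \<theta>)"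
    unfolding continuous_on_iff by (meson not_less)
  have "\<forall>k. \<exists>\<theta>'\<in>el_domain g n x. dist \<theta>' \<theta> < 1 / real (Suc k) \<and> e \<le> dist (L \<theta>') (L \<theta>)"
    using far by simp
  then obtain u where u: "\<And>k. u k \<in> el_domain g n x"
    and near: "\<And>k. dist (u k) \<theta> < 1 / real (Suc k)" and e: "\<And>k. e \<le> dist (L (u k)) (L \<theta>)"
    by metis
  have "(\<lambda>k. dist (u k) \<theta>) \<longlonglongrightarrow> 0"
    by (rule tendsto_sandwich[OF _ _ tendsto_const LIMSEQ_inverse_real_of_nat])
       (use near in \<open>auto simp: inverse_eq_divide intro!: always_eventually less_imp_le\<close>)
  then have "u \<longlonglongrightarrow> \<theta>" using tendsto_dist_iff by blast
  then obtain r where "(\<lambda>k. L (u (r k))) \<longlonglongrightarrow> L \<theta>"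
    using el_multiplier_limit_point[where g = g and u = u and L = "\<lambda>k. L (u k)" and lam = "L \<theta>"] cont[OF _ th] L u th uniq
      \<open>0 < n\<close> by blast
  then obtain k where "dist (L (u (r k))) (L \<theta>) < e"
    using \<open>e > 0\<close> unfolding lim_sequentially by blast
  then show False using e[of "r k"] by simp
qed

lemma continuous_on_el_loglik:
  fixes g :: "'a \<Rightarrow> 'b::metric_space \<Rightarrow> 'c::euclidean_space"
  assumes cont: "\<And>i \<theta>. i < n \<Longrightarrow> \<theta> \<in> el_domain g n x \<Longrightarrow> isCont (g (x i)) \<theta>"
    and uniq: "\<And>\<theta>. \<theta> \<in> el_domain g n x \<Longrightarrow> \<exists>!lam. el_multiplier g n x \<theta> lam"
    and "0 < n"
  shows "continuous_on (el_domain g n x) (el_loglik g n x)"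
proof -
  define L where "L \<theta> = (THE lam. el_multiplier g n x \<theta> lam)" for \<theta>
  have L: "el_multiplier g n x \<theta> (L \<theta>)" if "\<theta> \<in> el_domain g n x" for \<theta>
    unfolding L_def using uniq[OF that] by (rule theI')
  have contL: "continuous_on (el_domain g n x) L"
    using continuous_on_el_multiplier[OF cont uniq L \<open>0 < n\<close>] by blast
  have contg: "continuous_on (el_domain g n x) (g (x i))" if "i < n" for i
    using cont[OF that] by (simp add: continuous_at_imp_continuous_on)
  have "continuous_on (el_domain g n x) (\<lambda>\<theta>. 2 * (\<Sum>i<n. ln (1 + L \<theta> \<bullet> g (x i) \<theta>)))"
  proof (intro continuous_intros contL contg)
    show "\<forall>\<theta>\<in>el_domain g n x. 1 + L \<theta> \<bullet> g (x i) \<theta> \<noteq> 0" if "i \<in> {..<n}" for i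
      using L that unfolding el_multiplier_def by force
  qed auto
  then show ?thesis
    by (rule continuous_on_eq) (use el_loglik_multiplier[OF L \<open>0 < n\<close>] in auto)
qed

section \<open>The extension map\<close>

text \<open>The argument on the ray from \<open>t\<close> through \<open>z\<close> is run as a connectedness argument on
  \<open>[0, 1]\<close>. If \<open>f\<close> avoids the value \<open>1\<close>, the set \<open>T\<close> of positions in the domain with \<open>f < 1\<close> is open by
  continuity. It is also closed: \<open>f < 1\<close> bounds \<open>l\<close> along a sequence of positions that stays away
  from \<open>0\<close>, so its limit cannot leave the domain. Since \<open>0 \<in> T\<close>, also \<open>1 \<in> T\<close>, which contradicts
  \<open>f 1 \<ge> 1\<close>.\<close>
lemma el_extension_surj:
  fixes g :: "'a \<Rightarrow> 'b::real_normed_vector \<Rightarrow> 'c::euclidean_space"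
  assumes cont: "\<And>i \<theta>. i < n \<Longrightarrow> isCont (g (x i)) \<theta>"
    and op: "open (el_domain g n x)"
    and uniq: "\<And>\<theta>. \<theta> \<in> el_domain g n x \<Longrightarrow> \<exists>!lam. el_multiplier g n x \<theta> lam"
    and t: "t \<in> el_domain g n x"
    and "0 < n"
  shows "el_extension g n x t ` el_domain g n x = UNIV"
proof -
  have nn: "0 \<le> el_loglik g n x \<theta>" if "\<theta> \<in> el_domain g n x" for \<theta>
  proof -
    from uniq[OF that] obtain lam where "el_multiplier g n x \<theta> lam" by blast
    then show ?thesis using \<open>0 < n\<close> by (rule el_loglik_nonneg)
  qed
  have "z \<in> el_extension g n x t ` el_domain g n x" for z
  proof (rule ccontr)
    assume notin: "z \<notin> el_extension g n x t ` el_domain g n x"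
    define \<psi> where "\<psi> s = t + s *\<^sub>R (z - t)" for s :: real
    define f where "f s = s * expansion_factor n (el_loglik g n x (\<psi> s))" for s
    define U where "U = {0..1} \<inter> \<psi> -` el_domain g n x"
    define T where "T = {s \<in> U. f s < 1}"
    have cont\<psi>: "continuous_on A \<psi>" for A
      unfolding \<psi>_def by (intro continuous_intros)
    have contf: "continuous_on U f"
      unfolding f_def expansion_factor_def
      by (intro continuous_intros continuous_on_compose2[OF continuous_on_el_loglik cont\<psi>])
         (use cont uniq \<open>0 < n\<close> in \<open>auto simp: U_def\<close>)
    have ext: "el_extension g n x t (\<psi> s) = \<psi> (f s)" for s
      by (simp add: el_extension_def \<psi>_def f_def)
    have f1: "f s \<noteq> 1" if "s \<in> U" for s
    proof
      assume "f s = 1"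
      then have "el_extension g n x t (\<psi> s) = z" unfolding ext by (simp add: \<psi>_def)
      then show False using notin that by (auto simp: U_def)
    qed
    have fge: "s \<le> f s" if "s \<in> U" for s
      using nn[of "\<psi> s"] that mult_left_mono[of 1 "expansion_factor n (el_loglik g n x (\<psi> s))" s]
      by (simp add: f_def U_def expansion_factor_def)
    have "openin (top_of_set {0..1}) U"
      unfolding U_def by (rule continuous_openin_preimage_gen[OF cont\<psi> op])
    moreover have "openin (top_of_set U) T"
    proof -
      have "T = U \<inter> f -` {..<1}" by (auto simp: T_def)
      then show ?thesis using continuous_openin_preimage_gen[OF contf open_lessThan] by simp
    qed
    ultimately have "openin (top_of_set {0..1}) T"
      using openin_trans by blast
    moreover have "closedin (top_of_set {0..1}) T"
      unfolding closedin_limpt islimpt_sequential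
    proof (intro conjI allI impI)
      show "T \<subseteq> {0..1}" by (auto simp: T_def U_def)
      fix b assume "(\<exists>s. (\<forall>k. s k \<in> T - {b}) \<and> s \<longlonglongrightarrow> b) \<and> b \<in> {0..1}"
      then obtain s where sT: "\<And>k. s k \<in> T" and b: "b \<in> {0..1}" and lim: "s \<longlonglongrightarrow> b"
        by blast
      have bU: "b \<in> U"
      proof (cases "b = 0")
        case True
        then show ?thesis using t by (simp add: U_def \<psi>_def)
      next
        case False
        then have "0 < b" using b by simp
        \<comment> \<open>Positions above \<open>b / 2\<close> turn \<open>f < 1\<close> into the bound \<open>l \<le> 4 * n / b\<close>.\<close>
        then have "\<forall>\<^sub>F k in sequentially. b / 2 < s k"
          using order_tendstoD(1)[OF lim, of "b / 2"] by simp
        then obtain N where N: "\<And>k. k \<ge> N \<Longrightarrow> b / 2 < s k"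
          unfolding eventually_sequentially by blast
        have "\<psi> b \<in> el_domain g n x"
        proof (rule el_domain_limit_of_bounded_loglik)
          show "(\<lambda>k. \<psi> (s (k + N))) \<longlonglongrightarrow> \<psi> b"
            using LIMSEQ_ignore_initial_segment[OF lim, of N]
            unfolding \<psi>_def by (intro tendsto_intros)
          fix k
          have sk: "s (k + N) \<in> U" "f (s (k + N)) < 1" using sT[of "k + N"] by (auto simp: T_def)
          then show "\<exists>lam. el_multiplier g n x (\<psi> (s (k + N))) lam"
            using uniq by (intro ex1_implies_ex) (simp add: U_def)
          have "b / 2 < s (k + N)" using N by simp
          have el: "0 \<le> expansion_factor n (el_loglik g n x (\<psi> (s (k + N))))"
            using nn sk(1) by (simp add: expansion_factor_def U_def)
          have "b / 2 * expansion_factor n (el_loglik g n x (\<psi> (s (k + N)))) \<le> 1"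
            using mult_right_mono[OF less_imp_le[OF \<open>b / 2 < s (k + N)\<close>] el] sk(2) by (simp add: f_def)
          then have "b * (real n * 2) + b * el_loglik g n x (\<psi> (s (k + N))) \<le> real n * 4"
            using \<open>0 < n\<close> by (simp add: expansion_factor_def field_simps)
          moreover have "0 < b * (real n * 2)"
            using \<open>0 < b\<close> \<open>0 < n\<close> by (intro mult_pos_pos) auto
          ultimately have "b * el_loglik g n x (\<psi> (s (k + N))) \<le> real n * 4" by linarith
          then show "el_loglik g n x (\<psi> (s (k + N))) \<le> 4 * real n / b"
            using \<open>0 < b\<close> by (simp add: field_simps)
        qed (use cont \<open>0 < n\<close> in auto)
        then show ?thesis using b by (simp add: U_def)
      qed
      have "(\<lambda>k. f (s k)) \<longlonglongrightarrow> f b"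
        using continuous_on_tendsto_compose[OF contf lim bU] sT by (simp add: T_def)
      then have "f b \<le> 1"
        using sT by (intro LIMSEQ_le_const2) (auto simp: T_def less_imp_le)
      then show "b \<in> T" using f1[OF bU] bU by (simp add: T_def)
    qed
    ultimately have "T = {} \<or> T = {0..1}"
      using connected_Icc[of "0::real" 1] unfolding connected_clopen by blast
    moreover have "0 \<in> T"
      using t by (simp add: T_def U_def \<psi>_def f_def)
    ultimately have "1 \<in> T" by auto
    then show False using fge[of 1] by (simp add: T_def)
  qed
  then show ?thesis by blast
qed

text \<open>A fixed point other than \<open>t\<close> has \<open>l = 0\<close>, so it attains the upper bound \<open>1\<close> of the ratio and is
  a second maximizer.\<close>
lemma el_extension_fixed_point:
  assumes mult: "\<And>\<theta>. \<theta> \<in> el_domain g n x \<Longrightarrow> \<exists>lam. el_multiplier g n x \<theta> lam"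
    and t: "\<And>\<theta>. is_arg_max (el_ratio g n x) (\<lambda>\<theta>. \<theta> \<in> el_domain g n x) \<theta> \<longleftrightarrow> \<theta> = t"
    and "0 < n"
  shows "{\<theta> \<in> el_domain g n x. el_extension g n x t \<theta> = \<theta>} = {t}"
proof -
  have "\<theta> = t" if th: "\<theta> \<in> el_domain g n x" and fx: "el_extension g n x t \<theta> = \<theta>" for \<theta>
  proof (rule ccontr)
    assume "\<theta> \<noteq> t"
    obtain lam where "el_multiplier g n x \<theta> lam" using mult[OF th] by blast
    then have R: "0 < el_ratio g n x \<theta>" using \<open>0 < n\<close> by (rule el_ratio_pos_le_one)
    have "(el_loglik g n x \<theta> / (2 * real n)) *\<^sub>R (\<theta> - t) = 0"
      using fx by (simp add: el_extension_def expansion_factor_def algebra_simps)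
    then have "el_ratio g n x \<theta> = 1"
      using \<open>\<theta> \<noteq> t\<close> \<open>0 < n\<close> R by (simp add: el_loglik_def)
    then have "is_arg_max (el_ratio g n x) (\<lambda>\<theta>. \<theta> \<in> el_domain g n x) \<theta>"
      unfolding is_arg_max_def using th mult el_ratio_pos_le_one(2) \<open>0 < n\<close> by (metis not_less)
    then show False using t \<open>\<theta> \<noteq> t\<close> by blast
  qed
  moreover have "t \<in> el_domain g n x" using t unfolding is_arg_max_def by blast
  ultimately show ?thesis by (auto simp: el_extension_def)
qed

lemma el_extension_similarity_on_contour:
  fixes g :: "'a \<Rightarrow> 'b::real_normed_vector \<Rightarrow> 'c::real_vector"
  assumes "0 < expansion_factor n \<tau>"
  shows "similarity_on (el_extension g n x t) (el_contour g n x \<tau>)"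
proof -
  let ?S = "\<lambda>\<theta>. t + expansion_factor n \<tau> *\<^sub>R (\<theta> - t)"
  have "dist (?S u) (?S v) = expansion_factor n \<tau> * dist u v" for u v
    using assms by (simp add: dist_norm flip: scaleR_diff_right)
  then have "similarity_mapping ?S"
    unfolding similarity_mapping_def using assms by blast
  moreover have "el_extension g n x t \<theta> = ?S \<theta>" if "\<theta> \<in> el_contour g n x \<tau>" for \<theta>
    using that by (simp add: el_contour_def el_extension_def)
  ultimately show ?thesis
    unfolding similarity_on_def by blast
qed

section \<open>Almost sure continuity of the sample\<close>

text \<open>Condition 2 speaks of the distribution of \<open>X\<close>, which all observations share. As there are
  countably many observations, their exceptional null sets have a null union.\<close>
lemma AE_sample_continuous:
  fixes X :: "'w \<Rightarrow> real ^ 'd" and g :: "real ^ 'd \<Rightarrow> real ^ 'p \<Rightarrow> real ^ 'q"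
  assumes rv: "\<And>i::nat. Xs i \<in> borel_measurable M"
    and dist: "\<And>i. distr M borel (Xs i) = distr M borel X"
    and "condition2 M X g \<theta>0"
  shows "AE \<omega> in M. \<forall>i \<theta>. isCont (g (Xs i \<omega>)) \<theta>"
proof -
  from assms(3) obtain D1 where
    "AE x in distr M borel X. \<forall>\<theta>. (g x has_derivative blinfun_apply (D1 x \<theta>)) (at \<theta>)"
    unfolding condition2_def by (elim exE conjE) (auto elim!: AE_mp)
  then have "AE x in distr M borel X. \<forall>\<theta>. isCont (g x) \<theta>"
    by (rule AE_mp) (auto intro: has_derivative_continuous)
  then have "AE x in distr M borel (Xs i). \<forall>\<theta>. isCont (g x) \<theta>" for i
    by (subst dist)
  then have "AE \<omega> in M. \<forall>\<theta>. isCont (g (Xs i \<omega>)) \<theta>" for i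
    using AE_distrD[OF rv] by blast
  then show ?thesis
    unfolding AE_all_countable by blast
qed

theorem theorem1:
  fixes M :: "'w measure"
    and X :: "'w \<Rightarrow> real ^ 'd"
    and Xs :: "nat \<Rightarrow> 'w \<Rightarrow> real ^ 'd"
    and g :: "real ^ 'd \<Rightarrow> real ^ 'p \<Rightarrow> real ^ 'q"
    and \<theta>0 :: "real ^ 'p"
    and est :: "nat \<Rightarrow> 'w \<Rightarrow> real ^ 'p"
    and n :: nat
  assumes "prob_space M"
    and "X \<in> borel_measurable M"
    and "prob_space.indep_vars M (\<lambda>_. borel) Xs UNIV"
    and "\<And>i. distr M borel (Xs i) = distr M borel X"
    and "\<And>\<theta>. (\<lambda>x. g x \<theta>) \<in> borel_measurable borel"
    and "condition1 M X g \<theta>0"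
    and "condition2 M X g \<theta>0"
    and "condition3 M X g \<theta>0"
    and "\<And>m. est m \<in> borel_measurable M"
    and "bigo_in_probability M (\<lambda>m \<omega>. est m \<omega> - \<theta>0) (\<lambda>m. real m powr (- 1 / 2))"
    and "CARD('q) < n"
  shows "AE \<omega> in M. regular_sample g n (\<lambda>i. Xs i \<omega>) \<theta>0 (est n \<omega>) \<longrightarrow>
    (let x = (\<lambda>i. Xs i \<omega>); t = est n \<omega>; h = el_extension g n x t in
       {\<theta> \<in> el_domain g n x. h \<theta> = \<theta>} = {t} \<and>
       (\<forall>\<tau>\<ge>el_loglik g n x t. similarity_on h (el_contour g n x \<tau>)) \<and>
       h ` el_domain g n x = UNIV)"
proof -
  have "0 < n" using assms(11) by simp
  have rv: "Xs i \<in> borel_measurable M" for i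
    using assms(1,3) by (auto simp: prob_space.indep_vars_def)
  show ?thesis
    using AE_sample_continuous[OF rv assms(4) assms(7)]
  proof (rule AE_mp, intro AE_I2 impI)
    fix \<omega>
    assume cont: "\<forall>i \<theta>. isCont (g (Xs i \<omega>)) \<theta>"
      and reg: "regular_sample g n (\<lambda>i. Xs i \<omega>) \<theta>0 (est n \<omega>)"
    define x where "x = (\<lambda>i. Xs i \<omega>)"
    define t where "t = est n \<omega>"
    have op: "open (el_domain g n x)"
      and uniq: "\<And>\<theta>. \<theta> \<in> el_domain g n x \<Longrightarrow> \<exists>!lam. el_multiplier g n x \<theta> lam"
      and arg: "\<And>\<theta>. is_arg_max (el_ratio g n x) (\<lambda>\<theta>. \<theta> \<in> el_domain g n x) \<theta> \<longleftrightarrow> \<theta> = t"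
      using reg by (auto simp: regular_sample_def x_def t_def)
    have t: "t \<in> el_domain g n x" using arg unfolding is_arg_max_def by blast
    have "{\<theta> \<in> el_domain g n x. el_extension g n x t \<theta> = \<theta>} = {t}"
      by (rule el_extension_fixed_point[OF ex1_implies_ex[OF uniq] arg \<open>0 < n\<close>])
    moreover have "similarity_on (el_extension g n x t) (el_contour g n x \<tau>)"
      if "\<tau> \<ge> el_loglik g n x t" for \<tau>
    proof (rule el_extension_similarity_on_contour)
      from uniq[OF t] obtain lam where "el_multiplier g n x t lam" by blast
      then have "0 \<le> el_loglik g n x t" using \<open>0 < n\<close> by (rule el_loglik_nonneg)
      then have "0 \<le> \<tau>" using that by simp
      then show "0 < expansion_factor n \<tau>" by (simp add: expansion_factor_def add_pos_nonneg)
    qed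
    moreover have "el_extension g n x t ` el_domain g n x = UNIV"
      using cont by (intro el_extension_surj op uniq t \<open>0 < n\<close>) (auto simp: x_def)
    ultimately show "let x = (\<lambda>i. Xs i \<omega>); t = est n \<omega>; h = el_extension g n x t in
       {\<theta> \<in> el_domain g n x. h \<theta> = \<theta>} = {t} \<and>
       (\<forall>\<tau>\<ge>el_loglik g n x t. similarity_on h (el_contour g n x \<tau>)) \<and>
       h ` el_domain g n x = UNIV"
      unfolding Let_def x_def t_def by blast
  qed
qed

end
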